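(* Let $D(a)$ be a complex vector space, $a\colon D(a)\times D(a)\to\mathbf{C}$ a sesquilinear form, $H$ a complex Hilbert space and $j\colon D(a)\to H$ a linear map. Assume that $a$ is $j$-sectorial and that $j(D(a))$ is dense in $H$. Then: (a) There exists an operator $A$ in $H$ such that for all $x,f\in H$ one has $x\in D(A)$ and $Ax=f$ if and only if there exist $u_1,u_2,\ldots\in D(a)$ such that (I) $\lim_{n\to\infty}j(u_n)=x$ weakly in $H$, (II) $\sup_{n}\operatorname{Re}a(u_n)<\infty$, and (III) $\lim_{n\to\infty}a(u_n,v)=(f,j(v))_H$ for all $v\in D(a)$. (b) The operator $A$ of statement (a) is $m$-sectorial. (c) Let $x,f\in H$. Then $x\in D(A)$ and $Ax=f$ if and only if there exists a Cauchy sequence $u_1,u_2,\ldots$ in $(D(a),\|\cdot\|_a)$ such that $\lim_{n\to\infty}j(u_n)=x$ in $H$ and $\lim_{n\to\infty}a(u_n,v)=(f,j(v))_H$ for all $v\in D(a)$.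
   Context: Sesquilinear forms and inner products are linear in the first and conjugate-linear in the second variable; $a(u)=a(u,u)$; $\Sigma_\theta=\{re^{i\alpha}:r\ge0,\ |\alpha|\le\theta\}$. Operators are single-valued linear maps $A\colon D(A)\to H$ with $D(A)$ a linear subspace of $H$. The form $a$ is $j$-sectorial if there are $\gamma\in\mathbf{R}$ (a vertex) and $\theta\in[0,\frac\pi2)$ (a semi-angle) with $a(u)-\gamma\|j(u)\|_H^2\in\Sigma_\theta$ for all $u\in D(a)$. Then $D(a)$ carries the seminorm $\|u\|_a=(\operatorname{Re}a(u)+(1-\gamma)\|j(u)\|_H^2)^{1/2}$; Cauchy sequences in a semi-normed space are defined in the obvious way. An operator $A$ in $H$ is sectorial if there are $\gamma\in\mathbf{R}$ (vertex) and $\theta\in[0,\frac\pi2)$ with $(Ax,x)_H-\gamma\|x\|_H^2\in\Sigma_\theta$ for all $x\in D(A)$; it is $m$-sectorial if it is sectorial and $\lambda I-A$ is surjective for some $\lambda\in\mathbf{R}$ with $\lambda<\gamma$. *)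

theory Defs
  imports "HOL-Analysis.Analysis"
begin

class scaleC =
  fixes scaleC :: "complex \<Rightarrow> 'a \<Rightarrow> 'a"  (infixr \<open>*\<^sub>C\<close> 75)

class complex_vector = scaleC + ab_group_add +
  assumes scaleC_add_right: "c *\<^sub>C (x + y) = c *\<^sub>C x + c *\<^sub>C y"
    and scaleC_add_left: "(c + d) *\<^sub>C x = c *\<^sub>C x + d *\<^sub>C x"
    and scaleC_scaleC: "c *\<^sub>C d *\<^sub>C x = (c * d) *\<^sub>C x"
    and scaleC_one: "1 *\<^sub>C x = x"

global_interpretation complex_vector:
  vector_space "scaleC :: complex \<Rightarrow> 'a \<Rightarrow> 'a::complex_vector"
  by unfold_locales (simp_all add: scaleC_add_right scaleC_add_left scaleC_scaleC scaleC_one)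

abbreviation clinear :: "('a::complex_vector \<Rightarrow> 'b::complex_vector) \<Rightarrow> bool"
  where "clinear \<equiv> Vector_Spaces.linear scaleC scaleC"

abbreviation csubspace :: "'a::complex_vector set \<Rightarrow> bool"
  where "csubspace \<equiv> module.subspace scaleC"

text \<open>The inner product is linear in the first variable. Its real part is required to be the
  real inner product of the library, so that norm, distance and topology are the library's;
  definiteness is inherited from there. See \<open>norm_eq_sqrt_cinner\<close> and \<open>scaleR_scaleC\<close>.\<close>

class complex_inner = complex_vector + real_inner +
  fixes cinner :: "'a \<Rightarrow> 'a \<Rightarrow> complex"
  assumes cinner_commute: "cinner x y = cnj (cinner y x)"
    and cinner_add_left: "cinner (x + y) z = cinner x z + cinner y z"
    and cinner_scaleC_left: "cinner (c *\<^sub>C x) y = c * cinner x y"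
    and inner_eq_Re_cinner: "x \<bullet> y = Re (cinner x y)"

class chilbert_space = complex_inner + complete_space

lemma cinner_self: "cinner x x = complex_of_real ((norm x)\<^sup>2)"
proof -
  have "Im (cinner x x) = 0"
    by (metis cinner_commute cnj.sel(2) neg_equal_zero)
  then show ?thesis
    by (simp add: complex_eq_iff dot_square_norm flip: inner_eq_Re_cinner)
qed

lemma norm_eq_sqrt_cinner: "norm x = sqrt (cmod (cinner x x))"
  by (simp add: cinner_self norm_power)

lemma scaleR_scaleC: "r *\<^sub>R x = complex_of_real r *\<^sub>C (x::'a::complex_inner)"
proof -
  have "(r *\<^sub>R x) \<bullet> z = (complex_of_real r *\<^sub>C x) \<bullet> z" for z
    by (metis inner_eq_Re_cinner cinner_scaleC_left inner_scaleR_left Re_complex_of_real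
        times_complex.simps(1) Im_complex_of_real mult_zero_left diff_zero)
  then have "(r *\<^sub>R x - complex_of_real r *\<^sub>C x) \<bullet> z = 0" for z
    by (simp add: inner_diff_left)
  then show ?thesis
    by (metis inner_eq_zero_iff right_minus_eq)
qed

instantiation complex :: chilbert_space
begin

definition scaleC_complex :: "complex \<Rightarrow> complex \<Rightarrow> complex"
  where "scaleC_complex c z = c * z"

definition cinner_complex :: "complex \<Rightarrow> complex \<Rightarrow> complex"
  where "cinner_complex z w = z * cnj w"

instance
  by standard (simp_all add: scaleC_complex_def cinner_complex_def algebra_simps inner_complex_def)

end

definition weakly_tendsto :: "(nat \<Rightarrow> 'h::chilbert_space) \<Rightarrow> 'h \<Rightarrow> bool"
  where "weakly_tendsto X x \<longleftrightarrow>
    (\<forall>\<phi> :: 'h \<Rightarrow> complex. clinear \<phi> \<and> continuous_on UNIV \<phi> \<longrightarrow> (\<lambda>n. \<phi> (X n)) \<longlonglongrightarrow> \<phi> x)"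

definition sesquilinear :: "('v::complex_vector \<Rightarrow> 'v \<Rightarrow> complex) \<Rightarrow> bool"
  where "sesquilinear a \<longleftrightarrow>
    (\<forall>u v w. a (u + v) w = a u w + a v w) \<and>
    (\<forall>c u w. a (c *\<^sub>C u) w = c * a u w) \<and>
    (\<forall>u v w. a u (v + w) = a u v + a u w) \<and>
    (\<forall>c u v. a u (c *\<^sub>C v) = cnj c * a u v)"

definition sector :: "real \<Rightarrow> complex set"
  where "sector \<theta> = {rcis r \<alpha> | r \<alpha>. 0 \<le> r \<and> \<bar>\<alpha>\<bar> \<le> \<theta>}"

definition j_sectorial_with ::
    "('v \<Rightarrow> 'v \<Rightarrow> complex) \<Rightarrow> ('v \<Rightarrow> 'h::chilbert_space) \<Rightarrow> real \<Rightarrow> real \<Rightarrow> bool"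
  where "j_sectorial_with a j \<gamma> \<theta> \<longleftrightarrow>
    \<theta> \<in> {0..<pi/2} \<and> (\<forall>u. a u u - complex_of_real (\<gamma> * (norm (j u))\<^sup>2) \<in> sector \<theta>)"

definition j_sectorial :: "('v \<Rightarrow> 'v \<Rightarrow> complex) \<Rightarrow> ('v \<Rightarrow> 'h::chilbert_space) \<Rightarrow> bool"
  where "j_sectorial a j \<longleftrightarrow> (\<exists>\<gamma> \<theta>. j_sectorial_with a j \<gamma> \<theta>)"

definition form_seminorm ::
    "('v \<Rightarrow> 'v \<Rightarrow> complex) \<Rightarrow> ('v \<Rightarrow> 'h::chilbert_space) \<Rightarrow> real \<Rightarrow> 'v \<Rightarrow> real"
  where "form_seminorm a j \<gamma> u = sqrt (Re (a u u) + (1 - \<gamma>) * (norm (j u))\<^sup>2)"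

definition seminorm_Cauchy :: "('v::ab_group_add \<Rightarrow> real) \<Rightarrow> (nat \<Rightarrow> 'v) \<Rightarrow> bool"
  where "seminorm_Cauchy p u \<longleftrightarrow> (\<forall>e>0. \<exists>N. \<forall>m\<ge>N. \<forall>n\<ge>N. p (u m - u n) < e)"

text \<open>An operator \<open>A\<close> in \<open>H\<close> is a partial function with domain \<open>dom A\<close>; thus \<open>A x = Some f\<close>
  says that \<open>x\<close> lies in the domain of \<open>A\<close> and is mapped to \<open>f\<close>.\<close>

definition linear_operator :: "('h::chilbert_space \<rightharpoonup> 'h) \<Rightarrow> bool"
  where "linear_operator A \<longleftrightarrow>
    csubspace (dom A) \<and>
    (\<forall>x y f g. A x = Some f \<longrightarrow> A y = Some g \<longrightarrow> A (x + y) = Some (f + g)) \<and>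
    (\<forall>c x f. A x = Some f \<longrightarrow> A (c *\<^sub>C x) = Some (c *\<^sub>C f))"

definition sectorial_with :: "('h::chilbert_space \<rightharpoonup> 'h) \<Rightarrow> real \<Rightarrow> real \<Rightarrow> bool"
  where "sectorial_with A \<gamma> \<theta> \<longleftrightarrow>
    \<theta> \<in> {0..<pi/2} \<and>
    (\<forall>x f. A x = Some f \<longrightarrow> cinner f x - complex_of_real (\<gamma> * (norm x)\<^sup>2) \<in> sector \<theta>)"

text \<open>The vertex \<open>\<gamma>\<close> that bounds \<open>\<mu>\<close> may be any vertex of \<open>A\<close>; vertices are not unique.\<close>

definition m_sectorial :: "('h::chilbert_space \<rightharpoonup> 'h) \<Rightarrow> bool"
  where "m_sectorial A \<longleftrightarrow>
    (\<exists>\<gamma> \<theta>. sectorial_with A \<gamma> \<theta> \<and>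
      (\<exists>\<mu><\<gamma>. \<forall>y. \<exists>x f. A x = Some f \<and> complex_of_real \<mu> *\<^sub>C x - f = y))"

end

theory Submission
  imports Defs
begin

text \<open>With a vertex \<open>\<gamma>\<close>, the form \<open>b u v = a u v + (1 - \<gamma>) (j u, j v)\<close> is coercive for its own seminorm
  \<open>N u = sqrt (Re (b u u))\<close>, which is \<open>\<parallel>u\<parallel>\<^sub>a\<close> and dominates \<open>\<parallel>j u\<parallel>\<close>. Instead of completing the domain,
  one proves Lax--Milgram approximately: bounded antilinear functionals are represented by \<open>b\<close> up to
  an arbitrarily small multiple of \<open>N\<close>. By coercivity the approximate solutions form a Cauchy
  sequence, which yields the surjectivity in (b). If \<open>u n\<close> is as in (a) and \<open>w n\<close> is a Cauchy sequence
  solving the same limit equation, then \<open>d n = w n - u n\<close> is bounded and \<open>b (d n) v \<rightarrow> 0\<close> for all \<open>v\<close>.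
  Applying the approximate Lax--Milgram lemma to the adjoint form gives \<open>j (d n) \<rightarrow> 0\<close> weakly, so the
  limit of \<open>j (w n)\<close> is \<open>x\<close>. This is the equivalence of (a) and (c), without weak compactness.\<close>

section \<open>Sectors and the complex inner product\<close>

text \<open>For \<open>\<theta> < pi / 2\<close> the cosine is positive on the admissible arguments
  and \<open>tan\<close> is monotone there, so the polar condition becomes two non-strict linear
  inequalities. These survive limits, and \<open>tan \<theta>\<close> becomes the constant
  \<open>T\<close> of the later estimates.\<close>

lemma sector_iff:
  assumes "0 \<le> \<theta>" "\<theta> < pi / 2"
  shows "z \<in> sector \<theta> \<longleftrightarrow> 0 \<le> Re z \<and> \<bar>Im z\<bar> \<le> tan \<theta> * Re z"
proof
  assume "z \<in> sector \<theta>"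
  then obtain r \<alpha> where z: "z = rcis r \<alpha>" and r: "0 \<le> r" and \<alpha>: "\<bar>\<alpha>\<bar> \<le> \<theta>"
    unfolding sector_def by blast
  have cos: "0 < cos \<alpha>"
    using \<alpha> assms by (intro cos_gt_zero_pi) auto
  have "\<bar>sin \<alpha>\<bar> = tan \<bar>\<alpha>\<bar> * cos \<alpha>"
  proof -
    have "0 \<le> sin \<bar>\<alpha>\<bar>"
      using \<alpha> assms by (intro sin_ge_zero) auto
    then show ?thesis
      using cos by (cases "0 \<le> \<alpha>") (simp_all add: tan_def)
  qed
  also have "tan \<bar>\<alpha>\<bar> \<le> tan \<theta>"
    using \<alpha> assms by (intro tan_mono_le) auto
  finally have "\<bar>sin \<alpha>\<bar> \<le> tan \<theta> * cos \<alpha>"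
    using cos by simp
  then have "r * \<bar>sin \<alpha>\<bar> \<le> r * (tan \<theta> * cos \<alpha>)"
    using r by (intro mult_left_mono)
  then show "0 \<le> Re z \<and> \<bar>Im z\<bar> \<le> tan \<theta> * Re z"
    using r cos by (simp add: z Re_rcis Im_rcis abs_mult algebra_simps)
next
  assume z: "0 \<le> Re z \<and> \<bar>Im z\<bar> \<le> tan \<theta> * Re z"
  show "z \<in> sector \<theta>"
  proof (cases "Re z = 0")
    case True
    with z have "z = rcis 0 0"
      by (simp add: complex_eq_iff)
    then show ?thesis
      using assms unfolding sector_def by (intro CollectI exI[of _ 0]) simp
  next
    case False
    with z have pos: "0 < Re z" by simp
    define \<alpha> where "\<alpha> = Arg z"
    have z_eq: "z = rcis (cmod z) \<alpha>"
      by (simp add: \<alpha>_def rcis_cmod_Arg)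
    have \<alpha>: "\<bar>\<alpha>\<bar> < pi / 2"
      using pos Arg_Re_pos by (simp add: \<alpha>_def)
    have "Re z = cmod z * cos \<alpha>" "Im z = cmod z * sin \<alpha>"
      using z_eq by (metis Re_rcis, metis Im_rcis)
    moreover have "cmod z \<noteq> 0"
      using pos by auto
    ultimately have "tan \<alpha> = Im z / Re z"
      by (simp add: tan_def)
    then have "\<bar>tan \<alpha>\<bar> \<le> tan \<theta>"
      using z pos by (simp add: abs_divide pos_divide_le_eq)
    then have "tan \<bar>\<alpha>\<bar> \<le> tan \<theta>"
      by (cases "\<alpha> \<ge> 0") simp_all
    then have "\<bar>\<alpha>\<bar> \<le> \<theta>"
      using assms \<alpha> by (subst (asm) tan_mono_le_eq) auto
    then show ?thesis
      using z_eq norm_ge_zero unfolding sector_def by blast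
  qed
qed

text \<open>Rotation by a unimodular factor upgrades an estimate of a real part to an estimate of a
  modulus.\<close>

lemma obtain_phase:
  obtains c where "cmod c = 1" "c * z = complex_of_real (cmod z)"
proof (cases "z = 0")
  case True
  then show ?thesis using that[of 1] by simp
next
  case False
  show ?thesis
  proof (rule that[of "cnj z / cmod z"])
    show "cmod (cnj z / complex_of_real (cmod z)) = 1"
      using False by (simp add: norm_divide)
    have "cnj z * z = complex_of_real (cmod z) * complex_of_real (cmod z)"
      using complex_norm_square[of z] by (simp only: of_real_mult power2_eq_square mult.commute[of z])
    then have "cnj z * z / complex_of_real (cmod z) = complex_of_real (cmod z)"
      using False by (simp only:) simp
    then show "cnj z / complex_of_real (cmod z) * z = complex_of_real (cmod z)"
      by (simp only: times_divide_eq_left)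
  qed
qed

lemma cinner_add_right: "cinner x (y + z) = cinner x y + cinner x z"
  using cinner_commute[of x "y + z"] cinner_commute[of x y] cinner_commute[of x z]
  by (simp add: cinner_add_left)

lemma cinner_scaleC_right: "cinner x (c *\<^sub>C y) = cnj c * cinner x y"
  using cinner_commute[of x "c *\<^sub>C y"] cinner_commute[of x y]
  by (simp add: cinner_scaleC_left)

lemma norm_scaleC: "norm (c *\<^sub>C x) = cmod c * norm (x::'a::complex_inner)"
proof -
  have "cmod (cinner (c *\<^sub>C x) (c *\<^sub>C x)) = (cmod c)\<^sup>2 * cmod (cinner x x)"
    by (simp add: cinner_scaleC_left cinner_scaleC_right norm_mult power2_eq_square)
  then show ?thesis
    by (simp add: norm_eq_sqrt_cinner[of x] norm_eq_sqrt_cinner[of "c *\<^sub>C x"] real_sqrt_mult)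
qed

text \<open>The real Cauchy-Schwarz inequality is applied to the rotated vector
  \<open>c *\<^sub>C x\<close>.\<close>

lemma norm_cinner_le: "cmod (cinner x y) \<le> norm x * norm y"
proof -
  obtain c where c: "cmod c = 1" "c * cinner x y = complex_of_real (cmod (cinner x y))"
    by (rule obtain_phase)
  then have "cmod (cinner x y) = (c *\<^sub>C x) \<bullet> y"
    by (simp add: inner_eq_Re_cinner cinner_scaleC_left)
  also have "\<dots> \<le> norm x * norm y"
    using norm_cauchy_schwarz[of "c *\<^sub>C x" y] c by (simp add: norm_scaleC)
  finally show ?thesis .
qed

lemma bounded_bilinear_cinner: "bounded_bilinear cinner"
proof
  show "\<exists>K. \<forall>a b. cmod (cinner a b) \<le> norm a * norm b * K"
    by (rule exI[of _ 1]) (simp add: norm_cinner_le)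
qed (simp_all add: cinner_add_left cinner_add_right scaleR_scaleC cinner_scaleC_left
    cinner_scaleC_right scaleC_complex_def)

lemmas tendsto_cinner = bounded_bilinear.tendsto[OF bounded_bilinear_cinner]

lemma cinner_diff_left: "cinner (x - y) z = cinner x z - cinner y z"
  by (rule bounded_bilinear.diff_left[OF bounded_bilinear_cinner])

section \<open>Weak convergence and the uniform boundedness principle\<close>

lemma weakly_tendsto_cinner:
  assumes "weakly_tendsto X x"
  shows "(\<lambda>n. cinner (X n) y) \<longlonglongrightarrow> cinner x y"
proof -
  have "clinear (\<lambda>z. cinner z y)"
    by unfold_locales (simp_all add: cinner_add_left cinner_scaleC_left scaleC_complex_def)
  moreover have "continuous_on UNIV (\<lambda>z. cinner z y)"
    by (intro bounded_bilinear.continuous_on[OF bounded_bilinear_cinner] continuous_intros)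
  ultimately show ?thesis
    using assms unfolding weakly_tendsto_def by blast
qed

lemma tendsto_imp_weakly_tendsto:
  assumes "X \<longlonglongrightarrow> x"
  shows "weakly_tendsto X x"
  unfolding weakly_tendsto_def
proof (intro allI impI, elim conjE)
  fix \<phi> :: "'a \<Rightarrow> complex"
  assume "continuous_on UNIV \<phi>"
  then show "(\<lambda>n. \<phi> (X n)) \<longlonglongrightarrow> \<phi> x"
    by (rule continuous_on_tendsto_compose[OF _ assms]) simp_all
qed

text \<open>Uniform boundedness for functionals given by inner products: the closed sets
  \<open>F k\<close> cover the space, so by Baire one of them contains a ball, and this ball
  controls every \<open>X i\<close> in its own direction.\<close>

lemma pointwise_bounded_imp_bounded:
  fixes X :: "'i \<Rightarrow> 'a::{real_inner,complete_space}"
  assumes "\<And>y. bounded (range (\<lambda>i. X i \<bullet> y))"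
  shows "bounded (range X)"
proof -
  define F where "F k = {y. \<forall>i. \<bar>X i \<bullet> y\<bar> \<le> real k}" for k
  have closed: "closed (F k)" for k
  proof -
    have "F k = (\<Inter>i. {y. \<bar>X i \<bullet> y\<bar> \<le> real k})"
      by (auto simp: F_def)
    then show ?thesis
      by (simp only:) (intro closed_INT ballI closed_Collect_le continuous_intros)
  qed
  have cover: "\<Union> (range F) = UNIV"
  proof -
    have "\<exists>k. y \<in> F k" for y
    proof -
      obtain B where B: "\<And>i. \<bar>X i \<bullet> y\<bar> \<le> B"
        using assms[of y] unfolding bounded_iff by force
      have "y \<in> F (nat \<lceil>B\<rceil>)"
        unfolding F_def using order_trans[OF B real_nat_ceiling_ge] by blast
      then show ?thesis ..
    qed
    then show ?thesis by blast
  qed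
  have "\<exists>k. interior (F k) \<noteq> {}"
  proof (rule ccontr)
    assume "\<nexists>k. interior (F k) \<noteq> {}"
    then have "(euclidean::'a topology) interior_of \<Union> (range F) = {}"
    proof (intro Baire_category_alt disjI1 completely_metrizable_space_euclidean)
      fix S
      assume "S \<in> range F"
      then obtain k where "S = F k" ..
      then show "closedin euclidean S \<and> euclidean interior_of S = {}"
        using closed[of k] \<open>\<nexists>k. interior (F k) \<noteq> {}\<close> by simp
    qed simp
    then show False
      by (simp add: cover)
  qed
  then obtain k y where "y \<in> interior (F k)"
    by blast
  then obtain e where e: "e > 0" "cball y e \<subseteq> F k"
    using mem_interior_cball by blast
  have "norm (X i) \<le> 2 * real k / e" for i
  proof (cases "X i = 0")
    case False
    \<comment> \<open>The vector of length \<open>e\<close> along \<open>X i\<close>: both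
      \<open>y\<close> and \<open>y + z\<close> lie in \<open>F k\<close>, and their pairings with
      \<open>X i\<close> differ by \<open>e * norm (X i)\<close>.\<close>
    define z where "z = (e / norm (X i)) *\<^sub>R X i"
    have "norm z = e"
      using False e by (simp add: z_def)
    then have "y \<in> F k" "y + z \<in> F k"
      using e by (auto simp: dist_norm)
    then have "\<bar>X i \<bullet> y\<bar> \<le> k" "\<bar>X i \<bullet> y + X i \<bullet> z\<bar> \<le> k"
      by (auto simp: F_def inner_add_right)
    moreover have "X i \<bullet> z = e * norm (X i)"
      using False by (simp add: z_def dot_square_norm power2_eq_square)
    ultimately have "e * norm (X i) \<le> 2 * k"
      by linarith
    then show ?thesis
      using e by (simp add: field_simps)
  qed (use e in auto)
  then show ?thesis
    by (auto simp: bounded_iff)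
qed

text \<open>Needed for condition (II): on the diagonal, the original and the shifted form differ by
  a multiple of \<open>(norm (j u))\<^sup>2\<close>, which must stay bounded along the
  sequence.\<close>

lemma weakly_tendsto_imp_bounded:
  assumes "weakly_tendsto X x"
  shows "bounded (range X)"
proof (rule pointwise_bounded_imp_bounded)
  fix y
  have "(\<lambda>n. X n \<bullet> y) \<longlonglongrightarrow> x \<bullet> y"
    unfolding inner_eq_Re_cinner
    by (intro tendsto_Re weakly_tendsto_cinner assms)
  then show "bounded (range (\<lambda>n. X n \<bullet> y))"
    by (rule convergent_imp_bounded)
qed

section \<open>The approximate Lax--Milgram lemma\<close>

lemma sesquilinearD:
  assumes "sesquilinear b"
  shows sesquilinear_add_left: "b (u + v) w = b u w + b v w"
    and sesquilinear_scale_left: "b (c *\<^sub>C u) w = c * b u w"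
    and sesquilinear_add_right: "b u (v + w) = b u v + b u w"
    and sesquilinear_scale_right: "b u (c *\<^sub>C v) = cnj c * b u v"
    and sesquilinear_diff_left: "b (u - v) w = b u w - b v w"
    and sesquilinear_diff_right: "b u (v - w) = b u v - b u w"
proof -
  have add: "b (u + v) w = b u w + b v w" "b u (v + w) = b u v + b u w" for u v w
    using assms unfolding sesquilinear_def by blast+
  show "b (u + v) w = b u w + b v w" "b u (v + w) = b u v + b u w"
    by (rule add)+
  show "b (c *\<^sub>C u) w = c * b u w" "b u (c *\<^sub>C v) = cnj c * b u v"
    using assms unfolding sesquilinear_def by blast+
  show "b (u - v) w = b u w - b v w"
    using add(1)[of "u - v" v w] by simp
  show "b u (v - w) = b u v - b u w"
    using add(2)[of u "v - w" w] by simp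
qed

section \<open>The seminorm of a form and bounds of Cauchy-Schwarz type\<close>

definition form_norm :: "('v \<Rightarrow> 'v \<Rightarrow> complex) \<Rightarrow> 'v \<Rightarrow> real"
  where "form_norm b u = sqrt (Re (b u u))"

lemma form_norm_square: "0 \<le> Re (b u u) \<Longrightarrow> (form_norm b u)\<^sup>2 = Re (b u u)"
  by (simp add: form_norm_def)

lemma sesquilinear_scale_both:
  assumes "sesquilinear b"
  shows "b (c *\<^sub>C u) (c *\<^sub>C v) = complex_of_real ((cmod c)\<^sup>2) * b u v"
  unfolding complex_norm_square
  by (simp add: sesquilinear_scale_left[OF assms] sesquilinear_scale_right[OF assms] mult.assoc)

lemma form_norm_scale:
  assumes "sesquilinear b"
  shows "form_norm b (c *\<^sub>C u) = cmod c * form_norm b u"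
proof -
  have "Re (b (c *\<^sub>C u) (c *\<^sub>C u)) = (cmod c)\<^sup>2 * Re (b u u)"
    by (simp add: sesquilinear_scale_both[OF assms] flip: of_real_power)
  then show ?thesis
    by (simp add: form_norm_def real_sqrt_mult)
qed

text \<open>The discriminant argument: the optimal choice is \<open>t = c / P\<close>. It serves
  both the Cauchy-Schwarz type bound and the estimate for near-minimisers of a quadratic
  functional.\<close>

lemma le_sqrt_mult_sqrt_if_quadratic_nonneg:
  fixes c P Q :: real
  assumes "\<And>t. 0 < t \<Longrightarrow> 2 * t * c \<le> t\<^sup>2 * P + Q" "0 \<le> P" "0 \<le> Q"
  shows "c \<le> sqrt P * sqrt Q"
proof (cases "c \<le> 0")
  case True
  then show ?thesis
    using assms(2,3) by (smt (verit) mult_nonneg_nonneg real_sqrt_ge_zero)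
next
  case False
  show ?thesis
  proof (cases "P = 0")
    case True
    \<comment> \<open>With \<open>P = 0\<close> the right-hand side is constant in \<open>t\<close>;
      this \<open>t\<close> makes the left-hand side equal to \<open>Q + 1\<close>, a
      contradiction.\<close>
    have "2 * ((Q + 1) / (2 * c)) * c \<le> Q"
      using assms(1)[of "(Q + 1) / (2 * c)"] assms(3) False True by simp
    then show ?thesis
      using False by simp
  next
    case P: False
    then have "2 * (c / P) * c \<le> (c / P)\<^sup>2 * P + Q"
      using assms(1)[of "c / P"] assms(2) False by simp
    then have "c\<^sup>2 / P \<le> Q"
      using P by (simp add: power2_eq_square)
    then have "c\<^sup>2 \<le> P * Q"
      using P assms(2) by (simp add: pos_divide_le_eq mult.commute)
    then show ?thesis
      using real_le_rsqrt by (simp flip: real_sqrt_mult)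
  qed
qed

text \<open>Polarization of \<open>k\<close>, the diagonal bound and the parallelogram identity for
  \<open>b\<close> control \<open>Re (k u v)\<close> by a sum of squares. Rotating and rescaling
  \<open>u\<close> turns this into a product bound with the same constant \<open>T\<close>.\<close>

lemma hermitian_form_bound:
  assumes b: "sesquilinear b" "\<And>u. 0 \<le> Re (b u u)"
    and k: "sesquilinear k" "\<And>u v. k u v = cnj (k v u)"
    and k_le: "\<And>u. \<bar>Re (k u u)\<bar> \<le> T * Re (b u u)" and T: "0 \<le> T"
  shows "cmod (k u v) \<le> T * form_norm b u * form_norm b v"
proof -
  have Re_le: "2 * Re (k u v) \<le> T * (Re (b u u) + Re (b v v))" for u v
  proof -
    have "Re (k v u) = Re (k u v)"
      using k(2)[of u v] by simp
    then have "4 * Re (k u v) = Re (k (u + v) (u + v)) - Re (k (u - v) (u - v))"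
      by (simp add: sesquilinearD[OF k(1)])
    also have "\<dots> \<le> T * Re (b (u + v) (u + v)) + T * Re (b (u - v) (u - v))"
      using k_le[of "u + v"] k_le[of "u - v"] by linarith
    also have "\<dots> = 2 * (T * (Re (b u u) + Re (b v v)))"
      by (simp add: sesquilinearD[OF b(1)] algebra_simps)
    finally show ?thesis by simp
  qed
  have "cmod (k u v) \<le> sqrt (T * Re (b u u)) * sqrt (T * Re (b v v))"
  proof (rule le_sqrt_mult_sqrt_if_quadratic_nonneg)
    fix t :: real
    assume t: "0 < t"
    obtain c where c: "cmod c = 1" "c * k u v = complex_of_real (cmod (k u v))"
      by (rule obtain_phase)
    \<comment> \<open>The phase \<open>c\<close> makes \<open>k u' v\<close> real and nonnegative;
      the scale \<open>t\<close> is the free parameter of the discriminant argument.\<close>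
    define u' where "u' = (complex_of_real t * c) *\<^sub>C u"
    have "k u' v = complex_of_real (t * cmod (k u v))"
      by (simp add: u'_def sesquilinear_scale_left[OF k(1)] mult.assoc c)
    moreover have "Re (b u' u') = t\<^sup>2 * Re (b u u)"
      using t c by (simp add: u'_def sesquilinear_scale_both[OF b(1)] norm_mult flip: of_real_power)
    ultimately show "2 * t * cmod (k u v) \<le> t\<^sup>2 * (T * Re (b u u)) + T * Re (b v v)"
      using Re_le[of u' v] by (simp add: algebra_simps)
  qed (use b(2) T in simp_all)
  also have "\<dots> = T * form_norm b u * form_norm b v"
    using T by (simp add: form_norm_def real_sqrt_mult)
  finally show ?thesis .
qed

section \<open>Approximate solvability: the hermitian case and its stability under
  perturbation\<close>

definition antilinear :: "('v::complex_vector \<Rightarrow> complex) \<Rightarrow> bool"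
  where "antilinear l \<longleftrightarrow>
    (\<forall>u v. l (u + v) = l u + l v) \<and> (\<forall>c u. l (c *\<^sub>C u) = cnj c * l u)"

text \<open>This says that \<open>w \<mapsto> b w\<close> has dense range in the antidual of the semi-normed space, which
  makes sense without completing the space.\<close>

definition approx_solvable ::
    "('v::complex_vector \<Rightarrow> 'v \<Rightarrow> complex) \<Rightarrow> ('v \<Rightarrow> real) \<Rightarrow> bool"
  where "approx_solvable b p \<longleftrightarrow>
    (\<forall>l K \<epsilon>. antilinear l \<and> (\<forall>v. cmod (l v) \<le> K * p v) \<and> 0 < \<epsilon> \<longrightarrow>
      (\<exists>w. \<forall>v. cmod (b w v - l v) \<le> \<epsilon> * p v))"

text \<open>A Riesz representation without completeness: the quadratic functional \<open>J\<close>
  is bounded below, and a near-minimiser of \<open>J\<close> almost satisfies the equation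
  \<open>s w v = l v\<close> that an exact minimiser would satisfy.\<close>

lemma hermitian_approx_solvable:
  assumes s: "sesquilinear s" "\<And>u v. s u v = cnj (s v u)" "\<And>u. 0 \<le> Re (s u u)"
  shows "approx_solvable s (form_norm s)"
  unfolding approx_solvable_def
proof (intro allI impI, elim conjE)
  fix l K and \<epsilon> :: real
  assume l: "antilinear l" "\<forall>v. cmod (l v) \<le> K * form_norm s v" and \<epsilon>: "0 < \<epsilon>"
  define J where "J w = Re (s w w) - 2 * Re (l w)" for w
  have "- K\<^sup>2 \<le> J w" for w
  proof -
    have "Re (l w) \<le> K * form_norm s w"
      using l(2) complex_Re_le_cmod order_trans by blast
    moreover have "0 \<le> (form_norm s w - K)\<^sup>2" by simp
    ultimately show ?thesis
      unfolding J_def form_norm_square[of s w, OF s(3), symmetric]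
      by (simp add: power2_diff algebra_simps)
  qed
  then have bdd: "bdd_below (range J)"
    by (intro bdd_belowI[of _ "- K\<^sup>2"]) auto
  \<comment> \<open>The tolerance is \<open>\<epsilon>\<^sup>2\<close> because the discriminant
    argument takes its square root.\<close>
  obtain w where w: "J w < Inf (range J) + \<epsilon>\<^sup>2"
    using cInf_lessD[of "range J" "Inf (range J) + \<epsilon>\<^sup>2"] \<epsilon> by auto
  have J_ge: "J w - \<epsilon>\<^sup>2 \<le> J w'" for w'
    using w cInf_lower[OF _ bdd, of "J w'"] by force
  have "cmod (s w v - l v) \<le> \<epsilon> * form_norm s v" for v
  proof -
    have "cmod (s w v - l v) \<le> sqrt (Re (s v v)) * sqrt (\<epsilon>\<^sup>2)"
    proof (rule le_sqrt_mult_sqrt_if_quadratic_nonneg)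
      fix t :: real
      assume t: "0 < t"
      obtain c where c: "cmod c = 1" "c * (s w v - l v) = complex_of_real (cmod (s w v - l v))"
        by (rule obtain_phase)
      \<comment> \<open>A descent direction: since the second argument is antilinear, the linear
        term of \<open>J (w + z)\<close> becomes
        \<open>- 2 * t * cmod (s w v - l v)\<close>.\<close>
      define z where "z = (complex_of_real (- t) * cnj c) *\<^sub>C v"
      have "s w z - l z = complex_of_real (- t) * (c * (s w v - l v))"
      proof -
        have "s w z - l z = cnj (complex_of_real (- t) * cnj c) * (s w v - l v)"
          using l(1) by (simp only: z_def antilinear_def sesquilinear_scale_right[OF s(1)]
              right_diff_distrib)
        then show ?thesis by simp
      qed
      then have swz: "Re (s w z) - Re (l z) = - t * cmod (s w v - l v)"
        unfolding c(2) by (metis Re_complex_of_real minus_complex.simps(1) of_real_mult)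
      have szz: "Re (s z z) = t\<^sup>2 * Re (s v v)"
      proof -
        have "cmod (complex_of_real (- t) * cnj c) = t"
          using t c by (simp add: norm_mult)
        then show ?thesis
          unfolding z_def sesquilinear_scale_both[OF s(1)] by (simp flip: of_real_power)
      qed
      have "Re (s z w) = Re (s w z)"
        using s(2)[of z w] by simp
      then have "J (w + z) = J w + 2 * (Re (s w z) - Re (l z)) + Re (s z z)"
        using l(1) by (simp add: J_def antilinear_def sesquilinearD[OF s(1)])
      then show "2 * t * cmod (s w v - l v) \<le> t\<^sup>2 * Re (s v v) + \<epsilon>\<^sup>2"
        using J_ge[of "w + z"] swz szz by simp
    qed (use s(3) in simp_all)
    then show ?thesis
      using \<epsilon> by (simp add: form_norm_def mult.commute)
  qed
  then show "\<exists>w. \<forall>v. cmod (s w v - l v) \<le> \<epsilon> * form_norm s v"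
    by blast
qed

text \<open>A Neumann-type iteration: the residual for \<open>b'\<close> is solved approximately
  with \<open>b\<close>, and coercivity bounds the correction \<open>z\<close>, so exchanging
  \<open>b\<close> for \<open>b'\<close> costs only the factor \<open>q < 1\<close>. Finitely many
  corrections bring the residual below \<open>\<epsilon>\<close>.\<close>

lemma approx_solvable_perturb:
  assumes solv: "approx_solvable b p" and b': "sesquilinear b'"
    and p: "\<And>u. 0 \<le> p u" and coercive: "\<And>u. (p u)\<^sup>2 \<le> cmod (b u u)"
    and diff: "\<And>u v. cmod (b' u v - b u v) \<le> q * p u * p v" and q: "0 \<le> q" "q < 1"
  shows "approx_solvable b' p"
  unfolding approx_solvable_def
proof (intro allI impI, elim conjE)
  fix l K and \<epsilon> :: real
  assume l: "antilinear l" "\<forall>v. cmod (l v) \<le> K * p v" and \<epsilon>: "0 < \<epsilon>"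
  define residual where "residual w R \<longleftrightarrow> (\<forall>v. cmod (l v - b' w v) \<le> R * p v)" for w R
  have step: "\<exists>w'. residual w' ((1 + q) / 2 * R)" if w: "residual w R" and R: "0 < R" for w R
  proof -
    \<comment> \<open>Chosen so that the new residual bound
      \<open>\<delta> + q * (R + \<delta>)\<close> equals \<open>(1 + q) / 2 * R\<close>, halfway
      between \<open>q * R\<close> and \<open>R\<close>.\<close>
    define \<delta> where "\<delta> = (1 - q) / (2 * (1 + q)) * R"
    have \<delta>: "0 < \<delta>"
      using R q by (simp add: \<delta>_def)
    have "antilinear (\<lambda>v. l v - b' w v)"
      using l(1) by (auto simp: antilinear_def sesquilinearD[OF b'] algebra_simps)
    then obtain z where z: "\<And>v. cmod (b z v - (l v - b' w v)) \<le> \<delta> * p v"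
      using solv w \<delta> unfolding approx_solvable_def residual_def by meson
    have pz: "p z \<le> R + \<delta>"
    proof (cases "p z = 0")
      case False
      have "p z * p z \<le> cmod (b z z)"
        using coercive[of z] by (simp add: power2_eq_square)
      also have "\<dots> \<le> cmod (l z - b' w z) + cmod (b z z - (l z - b' w z))"
        by (rule norm_triangle_sub)
      also have "\<dots> \<le> R * p z + \<delta> * p z"
        using w z by (intro add_mono) (auto simp: residual_def)
      finally have "p z * p z \<le> (R + \<delta>) * p z"
        by (simp add: distrib_right)
      then show ?thesis
        using p[of z] False by simp
    qed (use R \<delta> in simp)
    have "cmod (l v - b' (w + z) v) \<le> (1 + q) / 2 * R * p v" for v
    proof -
      have "l v - b' (w + z) v = - ((b z v - (l v - b' w v)) + (b' z v - b z v))"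
        by (simp add: sesquilinearD[OF b'])
      then have "cmod (l v - b' (w + z) v) \<le> cmod (b z v - (l v - b' w v)) + cmod (b' z v - b z v)"
        by (metis norm_minus_cancel norm_triangle_ineq)
      also have "\<dots> \<le> \<delta> * p v + q * p z * p v"
        by (intro add_mono z diff)
      also have "\<dots> \<le> \<delta> * p v + q * (R + \<delta>) * p v"
        using pz p q by (intro add_left_mono mult_right_mono mult_left_mono) auto
      also have "\<dots> = ((1 + q) * \<delta> + q * R) * p v"
        by (simp add: algebra_simps)
      also have "(1 + q) * \<delta> + q * R = (1 + q) / 2 * R"
        using q by (simp add: \<delta>_def divide_simps) (simp add: algebra_simps)
      finally show ?thesis .
    qed
    then show ?thesis
      unfolding residual_def by blast
  qed
  define r where "r = (1 + q) / 2"
  have r: "0 < r" "r < 1"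
    using q by (auto simp: r_def)
  \<comment> \<open>The bound \<open>K\<close> may be zero or negative, while the iteration needs a
    positive starting residual bound.\<close>
  define R where "R = max K 1"
  have R: "0 < R" "K \<le> R"
    by (auto simp: R_def)
  have iterate: "\<exists>w. residual w (r ^ n * R)" for n
  proof (induction n)
    case 0
    have "b' 0 v = 0" for v
      using sesquilinear_diff_left[OF b', of 0 0 v] by simp
    moreover have "cmod (l v) \<le> R * p v" for v
      using l(2) R p mult_right_mono order_trans by blast
    ultimately have "residual 0 R"
      by (simp add: residual_def)
    then show ?case by auto
  next
    case (Suc n)
    then show ?case
      using step r(1) R(1) unfolding r_def[symmetric] by (auto simp: mult.assoc)
  qed
  have "(\<lambda>n. r ^ n * R) \<longlonglongrightarrow> 0 * R"
    by (intro tendsto_mult_right LIMSEQ_power_zero) (use r in simp)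
  then obtain n where n: "r ^ n * R < \<epsilon>"
    using order_tendstoD(2)[of _ 0 sequentially \<epsilon>] \<epsilon> by (auto simp: eventually_sequentially)
  obtain w where "residual w (r ^ n * R)"
    using iterate by blast
  then have "cmod (b' w v - l v) \<le> \<epsilon> * p v" for v
    using n p[of v] unfolding residual_def
    by (metis less_imp_le mult_right_mono norm_minus_commute order_trans)
  then show "\<exists>w. \<forall>v. cmod (b' w v - l v) \<le> \<epsilon> * p v"
    by blast
qed

section \<open>Sectorial forms with vertex zero; \<open>T\<close> is the tangent of the
  semi-angle\<close>

locale sectorial_form =
  fixes b :: "'v::complex_vector \<Rightarrow> 'v \<Rightarrow> complex" and T :: real
  assumes sesquilinear: "sesquilinear b"
    and T_nonneg: "0 \<le> T"
    and Re_nonneg: "0 \<le> Re (b u u)"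
    and Im_le: "\<bar>Im (b u u)\<bar> \<le> T * Re (b u u)"
begin

definition sym_part :: "'v \<Rightarrow> 'v \<Rightarrow> complex"
  where "sym_part u v = (b u v + cnj (b v u)) / 2"

definition skew_part :: "'v \<Rightarrow> 'v \<Rightarrow> complex"
  where "skew_part u v = (b u v - cnj (b v u)) / 2"

lemma sesquilinear_parts: "sesquilinear sym_part" "sesquilinear skew_part"
  unfolding sesquilinear_def sym_part_def skew_part_def
  by (auto simp: sesquilinearD[OF sesquilinear] field_simps)

lemma form_eq_parts: "b u v = sym_part u v + skew_part u v"
  by (simp add: sym_part_def skew_part_def field_simps)

lemma Re_sym_part: "Re (sym_part u u) = Re (b u u)"
  by (simp add: sym_part_def)

text \<open>Multiplying by \<open>- \<i>\<close> makes the skew part hermitian, with the imaginary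
  part of \<open>b u u\<close> on the diagonal; there the sector condition is exactly the required
  diagonal bound.\<close>

lemma skew_part_bound: "cmod (skew_part u v) \<le> T * form_norm b u * form_norm b v"
proof -
  have "cmod (- \<i> * skew_part u v) \<le> T * form_norm b u * form_norm b v"
  proof (rule hermitian_form_bound[OF sesquilinear Re_nonneg _ _ _ T_nonneg])
    show "Defs.sesquilinear (\<lambda>u v. - \<i> * skew_part u v)"
      using sesquilinear_parts(2) by (simp add: sesquilinear_def algebra_simps)
    show "- \<i> * skew_part u v = cnj (- \<i> * skew_part v u)" for u v
      by (simp add: skew_part_def field_simps)
    show "\<bar>Re (- \<i> * skew_part u u)\<bar> \<le> T * Re (b u u)" for u
      using Im_le[of u] by (simp add: skew_part_def)
  qed
  then show ?thesis
    by (simp add: norm_mult)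
qed

text \<open>The Cauchy-Schwarz inequality of the semi-inner product \<open>sym_part\<close>, whose
  seminorm is that of \<open>b\<close>; the triangle inequality rests on it.\<close>

lemma sym_part_bound: "cmod (sym_part u v) \<le> form_norm b u * form_norm b v"
proof -
  have "cmod (sym_part u v) \<le> 1 * form_norm b u * form_norm b v"
  proof (rule hermitian_form_bound[OF sesquilinear Re_nonneg sesquilinear_parts(1)])
    show "sym_part u v = cnj (sym_part v u)" for u v
      by (simp add: sym_part_def add.commute)
  qed (simp_all add: Re_sym_part Re_nonneg)
  then show ?thesis by simp
qed

lemma form_bound: "cmod (b u v) \<le> (1 + T) * form_norm b u * form_norm b v"
  using norm_triangle_ineq[of "sym_part u v" "skew_part u v"] sym_part_bound[of u v]
    skew_part_bound[of u v]
  by (simp add: form_eq_parts algebra_simps)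

lemma form_norm_nonneg: "0 \<le> form_norm b u"
  by (simp add: form_norm_def Re_nonneg)

lemma form_norm_sq: "(form_norm b u)\<^sup>2 = Re (b u u)"
  by (rule form_norm_square) (rule Re_nonneg)

lemma form_norm_triangle: "form_norm b (u + v) \<le> form_norm b u + form_norm b v"
proof (rule power2_le_imp_le)
  have "Re (b u v) + Re (b v u) = 2 * Re (sym_part u v)"
    by (simp add: sym_part_def)
  also have "\<dots> \<le> 2 * (form_norm b u * form_norm b v)"
    using sym_part_bound[of u v] complex_Re_le_cmod[of "sym_part u v"] by linarith
  finally show "(form_norm b (u + v))\<^sup>2 \<le> (form_norm b u + form_norm b v)\<^sup>2"
    by (simp add: power2_sum form_norm_sq sesquilinearD[OF sesquilinear])
qed (simp add: form_norm_nonneg)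

lemma form_norm_minus_commute: "form_norm b (u - v) = form_norm b (v - u)"
  by (simp add: form_norm_def sesquilinearD[OF sesquilinear] algebra_simps)

lemma form_norm_diff: "form_norm b (u - v) \<le> form_norm b u + form_norm b v"
proof -
  have "form_norm b (0 - v) = form_norm b v"
    using form_norm_minus_commute[of 0 v] by simp
  then show ?thesis
    using form_norm_triangle[of u "0 - v"] by simp
qed

lemma coercive: "(form_norm b u)\<^sup>2 \<le> cmod (b u u)"
  by (simp add: form_norm_sq complex_Re_le_cmod)

text \<open>Method of continuity along \<open>sym_part + t skew_part\<close>: every member of the family has the same
  seminorm and coercivity constant, so the admissible step length in \<open>t\<close> is uniform.\<close>

lemma approx_solvable: "approx_solvable b (form_norm b)"
proof -
  \<comment> \<open>The parameter runs from 0 to 1 in \<open>m\<close> steps. Each step changes the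
    form by at most \<open>T / m < 1\<close> relative to the seminorm, as the perturbation lemma
    demands.\<close>
  obtain m :: nat where m: "T < m"
    using reals_Archimedean2 by blast
  then have m_pos: "0 < m"
    using T_nonneg by (cases m) auto
  define c where "c i u v = sym_part u v + complex_of_real (real i / m) * skew_part u v" for i u v
  have sesq: "Defs.sesquilinear (c i)" for i
    using sesquilinear_parts by (simp add: sesquilinear_def c_def algebra_simps)
  have "approx_solvable (c i) (form_norm b)" for i
  proof (induction i)
    case 0
    have "form_norm sym_part = form_norm b"
      by (simp add: fun_eq_iff form_norm_def Re_sym_part)
    moreover have "approx_solvable sym_part (form_norm sym_part)"
    proof (rule hermitian_approx_solvable[OF sesquilinear_parts(1)])
      show "sym_part u v = cnj (sym_part v u)" for u v
        by (simp add: sym_part_def add.commute)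
    qed (simp add: Re_sym_part Re_nonneg)
    ultimately show ?case
      by (simp add: c_def[abs_def])
  next
    case (Suc i)
    show ?case
    proof (rule approx_solvable_perturb[OF Suc sesq form_norm_nonneg])
      fix u
      \<comment> \<open>The skew part is purely imaginary on the diagonal, so coercivity is the same
        for every \<open>i\<close>.\<close>
      have "Re (c i u u) = Re (b u u)"
        by (simp add: c_def sym_part_def skew_part_def)
      then show "(form_norm b u)\<^sup>2 \<le> cmod (c i u u)"
        by (metis complex_Re_le_cmod form_norm_sq)
    next
      fix u v
      have "c (Suc i) u v - c i u v = complex_of_real (1 / m) * skew_part u v"
        by (simp add: c_def add_divide_distrib distrib_right)
      then show "cmod (c (Suc i) u v - c i u v) \<le> T / m * form_norm b u * form_norm b v"
        using skew_part_bound[of u v] m_pos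
        by (simp add: norm_mult norm_divide divide_right_mono)
    qed (use m T_nonneg in auto)
  qed
  moreover have "c m = b"
    using m_pos by (simp add: fun_eq_iff c_def form_eq_parts)
  ultimately show ?thesis
    by (metis (full_types))
qed

text \<open>Conjugation preserves the sector. The adjoint allows the first argument of
  \<open>b\<close> to vary against a fixed second one.\<close>

lemma adjoint: "sectorial_form (\<lambda>u v. cnj (b v u)) T"
  using T_nonneg Re_nonneg Im_le
  by unfold_locales (auto simp: sesquilinear_def sesquilinearD[OF sesquilinear])

lemma form_norm_adjoint: "form_norm (\<lambda>u v. cnj (b v u)) = form_norm b"
  by (simp add: fun_eq_iff form_norm_def)

text \<open>Approximate solutions are taken with errors \<open>inverse (Suc n)\<close>. Testing the
  difference of two of them with itself, coercivity bounds its seminorm by the sum of the two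
  errors.\<close>

lemma solvable:
  assumes "antilinear l" "\<And>v. cmod (l v) \<le> K * form_norm b v"
  obtains w where "seminorm_Cauchy (form_norm b) w" "\<And>v. (\<lambda>n. b (w n) v) \<longlonglongrightarrow> l v"
proof -
  have "\<exists>w. \<forall>v. cmod (b w v - l v) \<le> inverse (Suc n) * form_norm b v" for n
  proof -
    have "0 < inverse (real (Suc n))"
      by simp
    then show ?thesis
      using approx_solvable assms unfolding approx_solvable_def by blast
  qed
  then obtain w where w: "\<And>n v. cmod (b (w n) v - l v) \<le> inverse (Suc n) * form_norm b v"
    by metis
  have diff: "form_norm b (w m - w n) \<le> inverse (Suc m) + inverse (Suc n)" for m n
  proof (cases "form_norm b (w m - w n) = 0")
    case False
    let ?v = "w m - w n"
    have "form_norm b ?v * form_norm b ?v \<le> cmod (b ?v ?v)"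
      using coercive[of ?v] by (simp add: power2_eq_square)
    also have "b ?v ?v = (b (w m) ?v - l ?v) - (b (w n) ?v - l ?v)"
      by (simp add: sesquilinear_diff_left[OF sesquilinear])
    also have "cmod \<dots> \<le> cmod (b (w m) ?v - l ?v) + cmod (b (w n) ?v - l ?v)"
      by (rule norm_triangle_ineq4)
    also have "\<dots> \<le> inverse (Suc m) * form_norm b ?v + inverse (Suc n) * form_norm b ?v"
      by (intro add_mono w)
    finally have "form_norm b ?v * form_norm b ?v
        \<le> (inverse (Suc m) + inverse (Suc n)) * form_norm b ?v"
      by (simp only: distrib_right)
    then show ?thesis
      using False form_norm_nonneg[of ?v] by (simp only: mult_le_cancel_right)
  qed simp
  have "seminorm_Cauchy (form_norm b) w"
    unfolding seminorm_Cauchy_def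
  proof (intro allI impI)
    fix e :: real
    assume "0 < e"
    then obtain N where N: "inverse (Suc N) < e / 2"
      using reals_Archimedean[of "e / 2"] by auto
    have "form_norm b (w m - w n) < e" if "m \<ge> N" "n \<ge> N" for m n
    proof -
      have "inverse (Suc m) \<le> inverse (Suc N)" "inverse (Suc n) \<le> inverse (Suc N)"
        using that by (simp_all add: le_imp_inverse_le)
      then show ?thesis
        using diff[of m n] N by linarith
    qed
    then show "\<exists>N. \<forall>m\<ge>N. \<forall>n\<ge>N. form_norm b (w m - w n) < e"
      by blast
  qed
  moreover have "(\<lambda>n. b (w n) v) \<longlonglongrightarrow> l v" for v
  proof (rule LIM_zero_cancel, rule Lim_null_comparison)
    show "\<forall>\<^sub>F n in sequentially. cmod (b (w n) v - l v) \<le> inverse (Suc n) * form_norm b v"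
      by (intro always_eventually allI w)
    show "(\<lambda>n. inverse (real (Suc n)) * form_norm b v) \<longlonglongrightarrow> 0"
      using tendsto_mult_left_zero[OF LIMSEQ_inverse_real_of_nat] by simp
  qed
  ultimately show ?thesis
    by (rule that)
qed

section \<open>Cauchy sequences for the seminorm\<close>

lemma seminorm_Cauchy_bounded:
  assumes "seminorm_Cauchy (form_norm b) u"
  obtains B where "\<And>n. form_norm b (u n) \<le> B"
proof -
  obtain N where N: "\<And>m n. m \<ge> N \<Longrightarrow> n \<ge> N \<Longrightarrow> form_norm b (u m - u n) < 1"
    using assms[unfolded seminorm_Cauchy_def, rule_format, of 1] by auto
  define B where "B = Max ((\<lambda>n. form_norm b (u n)) ` {..N}) + 1"
  have Max: "form_norm b (u n) \<le> B - 1" if "n \<le> N" for n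
    using that by (auto simp: B_def intro!: Max_ge)
  have "form_norm b (u n) \<le> B" for n
  proof (cases "n \<le> N")
    case False
    have "form_norm b (u n) \<le> form_norm b (u N) + form_norm b (u n - u N)"
      using form_norm_triangle[of "u N" "u n - u N"] by simp
    then show ?thesis
      using N[of n N] False Max[of N] by simp
  qed (use Max in fastforce)
  then show ?thesis
    by (rule that)
qed

lemma seminorm_Cauchy_add:
  assumes "seminorm_Cauchy (form_norm b) u" "seminorm_Cauchy (form_norm b) v"
  shows "seminorm_Cauchy (form_norm b) (\<lambda>n. u n + v n)"
  unfolding seminorm_Cauchy_def
proof (intro allI impI)
  fix e :: real
  assume "0 < e"
  then obtain M N where
    M: "\<And>m n. m \<ge> M \<Longrightarrow> n \<ge> M \<Longrightarrow> form_norm b (u m - u n) < e / 2" and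
    N: "\<And>m n. m \<ge> N \<Longrightarrow> n \<ge> N \<Longrightarrow> form_norm b (v m - v n) < e / 2"
    using assms unfolding seminorm_Cauchy_def by (meson half_gt_zero)
  have "form_norm b (u m + v m - (u n + v n)) < e" if "m \<ge> max M N" "n \<ge> max M N" for m n
    using form_norm_triangle[of "u m - u n" "v m - v n"] M[of m n] N[of m n] that
    by (simp add: add_diff_add)
  then show "\<exists>N. \<forall>m\<ge>N. \<forall>n\<ge>N. form_norm b (u m + v m - (u n + v n)) < e"
    by blast
qed

lemma seminorm_Cauchy_scale:
  assumes "seminorm_Cauchy (form_norm b) u"
  shows "seminorm_Cauchy (form_norm b) (\<lambda>n. c *\<^sub>C u n)"
  unfolding seminorm_Cauchy_def
proof (intro allI impI)
  fix e :: real
  assume "0 < e"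
  then have "0 < e / (cmod c + 1)"
    by (simp add: add_nonneg_pos)
  then obtain N where N: "\<And>m n. m \<ge> N \<Longrightarrow> n \<ge> N \<Longrightarrow> form_norm b (u m - u n) < e / (cmod c + 1)"
    using assms unfolding seminorm_Cauchy_def by meson
  have "form_norm b (c *\<^sub>C u m - c *\<^sub>C u n) < e" if "m \<ge> N" "n \<ge> N" for m n
  proof -
    have "form_norm b (c *\<^sub>C u m - c *\<^sub>C u n) = cmod c * form_norm b (u m - u n)"
      by (simp flip: complex_vector.scale_right_diff_distrib add: form_norm_scale[OF sesquilinear])
    also have "\<dots> \<le> (cmod c + 1) * form_norm b (u m - u n)"
      by (intro mult_right_mono form_norm_nonneg) simp
    also have "\<dots> < e"
      using N[OF that] by (simp add: pos_less_divide_eq add_nonneg_pos mult.commute)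
    finally show ?thesis .
  qed
  then show "\<exists>N. \<forall>m\<ge>N. \<forall>n\<ge>N. form_norm b (c *\<^sub>C u m - c *\<^sub>C u n) < e"
    by blast
qed

end

section \<open>Forms with a map into a Hilbert space\<close>

locale sectorial_form_map = sectorial_form b T
  for b :: "'v::complex_vector \<Rightarrow> 'v \<Rightarrow> complex" and T :: real +
  fixes j :: "'v \<Rightarrow> 'h::chilbert_space"
  assumes clinear_j: "clinear j"
    and norm_j_le: "norm (j u) \<le> form_norm b u"
begin

lemmas j_add = module_hom.add[OF module_hom_iff_linear[THEN iffD2, OF clinear_j]]
lemmas j_diff = module_hom.diff[OF module_hom_iff_linear[THEN iffD2, OF clinear_j]]
lemmas j_scale = module_hom.scale[OF module_hom_iff_linear[THEN iffD2, OF clinear_j]]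

lemma antilinear_cinner: "antilinear (\<lambda>v. cinner g (j v))"
  by (simp add: antilinear_def j_add j_scale cinner_add_right cinner_scaleC_right)

lemma cinner_j_le: "cmod (cinner g (j v)) \<le> norm g * form_norm b v"
  using norm_cinner_le[of g "j v"] norm_j_le[of v]
  by (meson mult_left_mono norm_ge_zero order_trans)

lemma seminorm_Cauchy_imp_convergent:
  assumes "seminorm_Cauchy (form_norm b) u"
  obtains x where "(\<lambda>n. j (u n)) \<longlonglongrightarrow> x"
proof -
  have "norm (j (u m) - j (u n)) \<le> form_norm b (u m - u n)" for m n
    using norm_j_le[of "u m - u n"] by (simp add: j_diff)
  then have "Cauchy (\<lambda>n. j (u n))"
    using assms unfolding seminorm_Cauchy_def Cauchy_iff by (meson le_less_trans)
  then show ?thesis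
    using that by (auto simp: Cauchy_convergent_iff convergent_def)
qed

text \<open>For the shifted form \<open>b\<close> this is the graph of \<open>A + (1 - \<gamma>) I\<close>.\<close>

definition form_graph :: "'h \<Rightarrow> 'h \<Rightarrow> bool"
  where "form_graph x g \<longleftrightarrow>
    (\<exists>u. seminorm_Cauchy (form_norm b) u \<and> (\<lambda>n. j (u n)) \<longlonglongrightarrow> x \<and>
      (\<forall>v. (\<lambda>n. b (u n) v) \<longlonglongrightarrow> cinner g (j v)))"

text \<open>The functional given by \<open>g\<close> is bounded because \<open>j\<close> is a
  contraction for the seminorm; for the same reason the images of the Cauchy sequence from
  \<open>solvable\<close> converge in the Hilbert space.\<close>

lemma form_graph_surj: "\<exists>x. form_graph x g"
proof -
  obtain w where w: "seminorm_Cauchy (form_norm b) w" "\<And>v. (\<lambda>n. b (w n) v) \<longlonglongrightarrow> cinner g (j v)"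
    using solvable[OF antilinear_cinner cinner_j_le] by blast
  obtain x where "(\<lambda>n. j (w n)) \<longlonglongrightarrow> x"
    using seminorm_Cauchy_imp_convergent[OF w(1)] by blast
  with w show ?thesis
    unfolding form_graph_def by blast
qed

lemma form_graph_add:
  assumes "form_graph x g" "form_graph y h"
  shows "form_graph (x + y) (g + h)"
proof -
  obtain u where u: "seminorm_Cauchy (form_norm b) u" "(\<lambda>n. j (u n)) \<longlonglongrightarrow> x"
      "\<And>v. (\<lambda>n. b (u n) v) \<longlonglongrightarrow> cinner g (j v)"
    using assms(1) unfolding form_graph_def by blast
  obtain w where w: "seminorm_Cauchy (form_norm b) w" "(\<lambda>n. j (w n)) \<longlonglongrightarrow> y"
      "\<And>v. (\<lambda>n. b (w n) v) \<longlonglongrightarrow> cinner h (j v)"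
    using assms(2) unfolding form_graph_def by blast
  show ?thesis
    unfolding form_graph_def j_add sesquilinear_add_left[OF sesquilinear] cinner_add_left
    by (rule exI[of _ "\<lambda>n. u n + w n"])
      (simp add: seminorm_Cauchy_add u w tendsto_add j_add sesquilinear_add_left[OF sesquilinear])
qed

lemma form_graph_scale:
  assumes "form_graph x g"
  shows "form_graph (c *\<^sub>C x) (c *\<^sub>C g)"
proof -
  obtain u where u: "seminorm_Cauchy (form_norm b) u" "(\<lambda>n. j (u n)) \<longlonglongrightarrow> x"
      "\<And>v. (\<lambda>n. b (u n) v) \<longlonglongrightarrow> cinner g (j v)"
    using assms(1) unfolding form_graph_def by blast
  have "(\<lambda>n. c *\<^sub>C j (u n)) \<longlonglongrightarrow> c *\<^sub>C x"
  proof (rule LIM_zero_cancel, rule Lim_null_comparison)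
    show "\<forall>\<^sub>F n in sequentially. norm (c *\<^sub>C j (u n) - c *\<^sub>C x) \<le> cmod c * norm (j (u n) - x)"
      by (simp flip: complex_vector.scale_right_diff_distrib add: norm_scaleC)
    show "(\<lambda>n. cmod c * norm (j (u n) - x)) \<longlonglongrightarrow> 0"
      by (intro tendsto_mult_right_zero tendsto_norm_zero LIM_zero u)
  qed
  moreover have "(\<lambda>n. c * b (u n) v) \<longlonglongrightarrow> c * cinner g (j v)" for v
    by (intro tendsto_mult_left u)
  ultimately show ?thesis
    unfolding form_graph_def using seminorm_Cauchy_scale[OF u(1)]
    by (intro exI[of _ "\<lambda>n. c *\<^sub>C u n"])
      (simp add: j_scale sesquilinear_scale_left[OF sesquilinear] cinner_scaleC_left)
qed

text \<open>The value \<open>b (u n) (u n) - b (u m) (u n)\<close> is small by the Cauchy property; let \<open>m \<rightarrow> \<infinity>\<close>.\<close>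

lemma tendsto_form_diagonal:
  assumes u: "seminorm_Cauchy (form_norm b) u" and x: "(\<lambda>n. j (u n)) \<longlonglongrightarrow> x"
    and g: "\<And>v. (\<lambda>n. b (u n) v) \<longlonglongrightarrow> cinner g (j v)"
  shows "(\<lambda>n. b (u n) (u n)) \<longlonglongrightarrow> cinner g x"
proof -
  obtain B where B: "\<And>n. form_norm b (u n) \<le> B"
    using seminorm_Cauchy_bounded[OF u] by blast
  have "0 \<le> B"
    using B[of 0] form_norm_nonneg[of "u 0"] by linarith
  have "(\<lambda>n. b (u n) (u n) - cinner g (j (u n))) \<longlonglongrightarrow> 0"
  proof (rule LIMSEQ_I)
    fix e :: real
    assume e: "0 < e"
    \<comment> \<open>Makes the continuity bound \<open>(1 + T) * d * (B + 1)\<close> equal to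
      \<open>e / 2\<close>; using \<open>B + 1\<close> keeps the denominator positive when
      \<open>B = 0\<close>.\<close>
    define d where "d = e / (2 * ((1 + T) * (B + 1)))"
    have d: "0 < d"
      using e T_nonneg \<open>0 \<le> B\<close> by (simp add: d_def)
    obtain N where N: "\<And>m n. m \<ge> N \<Longrightarrow> n \<ge> N \<Longrightarrow> form_norm b (u m - u n) < d"
      using u d unfolding seminorm_Cauchy_def by meson
    have "cmod (b (u n) (u n) - cinner g (j (u n))) < e" if n: "n \<ge> N" for n
    proof -
      have "cmod (b (u n) (u n) - cinner g (j (u n))) \<le> e / 2"
      proof (rule tendsto_upperbound)
        show "(\<lambda>m. cmod (b (u n) (u n) - b (u m) (u n)))
            \<longlonglongrightarrow> cmod (b (u n) (u n) - cinner g (j (u n)))"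
          by (intro tendsto_intros g)
        have "cmod (b (u n) (u n) - b (u m) (u n)) \<le> e / 2" if m: "m \<ge> N" for m
        proof -
          have "cmod (b (u n) (u n) - b (u m) (u n))
              \<le> (1 + T) * form_norm b (u n - u m) * form_norm b (u n)"
            using form_bound[of "u n - u m" "u n"]
            by (simp add: sesquilinear_diff_left[OF sesquilinear])
          also have "\<dots> \<le> (1 + T) * d * (B + 1)"
          proof (intro mult_mono)
            show "form_norm b (u n - u m) \<le> d"
              using N[OF n m] by simp
            show "form_norm b (u n) \<le> B + 1"
              using B[of n] by simp
          qed (use T_nonneg form_norm_nonneg d in simp_all)
          also have "\<dots> = e / 2"
          proof -
            have *: "p * (e / (2 * (p * q))) * q = e / 2" if "0 < p" "0 < q" for p q :: real
              using that by simp
            show ?thesis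
              unfolding d_def by (rule *) (use T_nonneg \<open>0 \<le> B\<close> in simp_all)
          qed
          finally show ?thesis .
        qed
        then show "\<forall>\<^sub>F m in sequentially. cmod (b (u n) (u n) - b (u m) (u n)) \<le> e / 2"
          unfolding eventually_sequentially by blast
      qed simp
      then show ?thesis
        using e by simp
    qed
    then show "\<exists>N. \<forall>n\<ge>N. norm (b (u n) (u n) - cinner g (j (u n)) - 0) < e"
      by auto
  qed
  moreover have "(\<lambda>n. cinner g (j (u n))) \<longlonglongrightarrow> cinner g x"
    by (intro tendsto_cinner tendsto_const x)
  ultimately show ?thesis
    by (rule Lim_transform[rotated])
qed

text \<open>Single-valuedness: if \<open>j (u n)\<close> tends to zero, so does the diagonal
  \<open>b (u n) (u n)\<close>, hence the seminorm of \<open>u n\<close>, hence every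
  \<open>b (u n) v\<close>. Thus \<open>g\<close> is orthogonal to the dense range of
  \<open>j\<close>.\<close>

lemma form_graph_zero_imp_zero:
  assumes dense: "closure (range j) = UNIV" and "form_graph 0 g"
  shows "g = 0"
proof -
  obtain u where u: "seminorm_Cauchy (form_norm b) u" "(\<lambda>n. j (u n)) \<longlonglongrightarrow> 0"
      "\<And>v. (\<lambda>n. b (u n) v) \<longlonglongrightarrow> cinner g (j v)"
    using assms(2) unfolding form_graph_def by blast
  have "cinner g 0 = 0"
    by (rule bounded_bilinear.zero_right[OF bounded_bilinear_cinner])
  then have "(\<lambda>n. b (u n) (u n)) \<longlonglongrightarrow> 0"
    using tendsto_form_diagonal[OF u] by simp
  then have "(\<lambda>n. sqrt (Re (b (u n) (u n)))) \<longlonglongrightarrow> sqrt (Re 0)"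
    by (intro tendsto_real_sqrt tendsto_Re)
  then have norm: "(\<lambda>n. form_norm b (u n)) \<longlonglongrightarrow> 0"
    by (simp add: form_norm_def)
  have "cinner g (j v) = 0" for v
  proof (rule LIMSEQ_unique[OF u(3)], rule Lim_null_comparison)
    show "\<forall>\<^sub>F n in sequentially. cmod (b (u n) v) \<le> (1 + T) * form_norm b (u n) * form_norm b v"
      by (intro always_eventually allI form_bound)
    show "(\<lambda>n. (1 + T) * form_norm b (u n) * form_norm b v) \<longlonglongrightarrow> 0"
      by (intro tendsto_mult_left_zero tendsto_mult_right_zero norm)
  qed
  then have "range j \<subseteq> {y. cinner g y = 0}"
    by auto
  moreover have "closed {y. cinner g y = 0}"
    by (intro closed_Collect_eq bounded_bilinear.continuous_on[OF bounded_bilinear_cinner]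
        continuous_intros)
  ultimately have "closure (range j) \<subseteq> {y. cinner g y = 0}"
    by (rule closure_minimal)
  then have "cinner g g = 0"
    using dense by auto
  then show ?thesis
    by (simp add: cinner_self)
qed

text \<open>Weak convergence to zero is tested against elements that the adjoint form represents up to a
  small error, which the bound on \<open>d\<close> absorbs.\<close>

lemma tendsto_cinner_zero_of_form_tendsto_zero:
  assumes B: "\<And>n. form_norm b (d n) \<le> B" and d: "\<And>v. (\<lambda>n. b (d n) v) \<longlonglongrightarrow> 0"
  shows "(\<lambda>n. cinner (j (d n)) h) \<longlonglongrightarrow> 0"
proof (rule LIMSEQ_I)
  fix e :: real
  assume e: "0 < e"
  have B0: "0 \<le> B"
    using B[of 0] form_norm_nonneg[of "d 0"] by linarith
  interpret adj: sectorial_form "\<lambda>u v. cnj (b v u)" T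
    by (rule adjoint)
  have "0 < e / (2 * (B + 1))"
    using e B0 by simp
  \<comment> \<open>The vector \<open>z\<close> depends on \<open>h\<close> and \<open>e\<close> but
    not on \<open>n\<close>, so the hypothesis on \<open>b (d n) v\<close> can be applied with
    \<open>v = z\<close>.\<close>
  then obtain z where z: "\<And>v. cmod (cnj (b v z) - cinner h (j v)) \<le> e / (2 * (B + 1)) * form_norm b v"
    using adj.approx_solvable[unfolded approx_solvable_def form_norm_adjoint] antilinear_cinner
      cinner_j_le by meson
  have small: "cmod (b (d n) z - cinner (j (d n)) h) \<le> e / 2" for n
  proof -
    have "b (d n) z - cinner (j (d n)) h = cnj (cnj (b (d n) z) - cinner h (j (d n)))"
      using cinner_commute[of "j (d n)" h] by simp
    then have "cmod (b (d n) z - cinner (j (d n)) h) = cmod (cnj (b (d n) z) - cinner h (j (d n)))"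
      by (simp only: complex_mod_cnj)
    also have "\<dots> \<le> e / (2 * (B + 1)) * form_norm b (d n)"
      by (rule z)
    also have "\<dots> \<le> e / (2 * (B + 1)) * (B + 1)"
      using B[of n] B0 e by (intro mult_left_mono) auto
    also have "\<dots> = e / 2"
    proof -
      have *: "e / (2 * p) * p = e / 2" if "0 < p" for p :: real
        using that by simp
      show ?thesis
        by (rule *) (use B0 in simp)
    qed
    finally show ?thesis .
  qed
  obtain N where N: "\<And>n. n \<ge> N \<Longrightarrow> cmod (b (d n) z) < e / 2"
    using LIMSEQ_D[OF d[of z], of "e / 2"] e by auto
  have "cmod (cinner (j (d n)) h) < e" if "n \<ge> N" for n
    using norm_triangle_sub[of "cinner (j (d n)) h" "b (d n) z"] small[of n] N[OF that]
    by (simp add: norm_minus_commute)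
  then show "\<exists>N. \<forall>n\<ge>N. norm (cinner (j (d n)) h - 0) < e"
    by auto
qed

lemma form_graph_iff_weak:
  "form_graph x g \<longleftrightarrow>
    (\<exists>u. weakly_tendsto (\<lambda>n. j (u n)) x \<and> bdd_above (range (\<lambda>n. Re (b (u n) (u n)))) \<and>
      (\<forall>v. (\<lambda>n. b (u n) v) \<longlonglongrightarrow> cinner g (j v)))"
  (is "_ \<longleftrightarrow> (\<exists>u. ?weak u)")
proof
  assume "form_graph x g"
  then obtain u where u: "seminorm_Cauchy (form_norm b) u" "(\<lambda>n. j (u n)) \<longlonglongrightarrow> x"
      "\<And>v. (\<lambda>n. b (u n) v) \<longlonglongrightarrow> cinner g (j v)"
    unfolding form_graph_def by blast
  obtain B where B: "\<And>n. form_norm b (u n) \<le> B"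
    using seminorm_Cauchy_bounded[OF u(1)] by blast
  have "Re (b (u n) (u n)) \<le> B\<^sup>2" for n
    using power_mono[OF B[of n] form_norm_nonneg, of 2] by (simp add: form_norm_sq)
  then have "bdd_above (range (\<lambda>n. Re (b (u n) (u n))))"
    by (intro bdd_aboveI[of _ "B\<^sup>2"]) auto
  then show "\<exists>u. ?weak u"
    using u tendsto_imp_weakly_tendsto by blast
next
  assume "\<exists>u. ?weak u"
  then obtain u where u: "weakly_tendsto (\<lambda>n. j (u n)) x"
      "bdd_above (range (\<lambda>n. Re (b (u n) (u n))))" "\<And>v. (\<lambda>n. b (u n) v) \<longlonglongrightarrow> cinner g (j v)"
    by blast
  \<comment> \<open>This sequence is built from \<open>g\<close> alone and replaces \<open>u\<close>
    as the witness for \<open>x\<close>, once its limit \<open>y\<close> is shown to equal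
    \<open>x\<close>.\<close>
  obtain w where w: "seminorm_Cauchy (form_norm b) w" "\<And>v. (\<lambda>n. b (w n) v) \<longlonglongrightarrow> cinner g (j v)"
    using solvable[OF antilinear_cinner cinner_j_le] by blast
  obtain y where y: "(\<lambda>n. j (w n)) \<longlonglongrightarrow> y"
    using seminorm_Cauchy_imp_convergent[OF w(1)] by blast
  obtain B where B: "\<And>n. form_norm b (w n) \<le> B"
    using seminorm_Cauchy_bounded[OF w(1)] by blast
  obtain C where C: "\<And>n. Re (b (u n) (u n)) \<le> C"
    using u(2) by (auto simp: bdd_above_def)
  have "form_norm b (u n) \<le> sqrt C" for n
    unfolding form_norm_def by (intro real_sqrt_le_mono C)
  then have "form_norm b (w n - u n) \<le> B + sqrt C" for n
    using form_norm_diff[of "w n" "u n"] B[of n] by (meson add_mono order_trans)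
  moreover have "(\<lambda>n. b (w n - u n) v) \<longlonglongrightarrow> 0" for v
    using tendsto_diff[OF w(2)[of v] u(3)[of v]] by (simp add: sesquilinear_diff_left[OF sesquilinear])
  ultimately have weak: "(\<lambda>n. cinner (j (w n - u n)) h) \<longlonglongrightarrow> 0" for h
    by (rule tendsto_cinner_zero_of_form_tendsto_zero)
  have "cinner (y - x) h = 0" for h
  proof (rule LIMSEQ_unique[OF _ weak])
    show "(\<lambda>n. cinner (j (w n - u n)) h) \<longlonglongrightarrow> cinner (y - x) h"
      unfolding j_diff cinner_diff_left
      by (intro tendsto_diff tendsto_cinner y tendsto_const weakly_tendsto_cinner u)
  qed
  from this[of "y - x"] have "y = x"
    by (simp add: cinner_self)
  then show "form_graph x g"
    using w y unfolding form_graph_def by blast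
qed

end

section \<open>The shift by the vertex and its effect on conditions (I) to (III)\<close>

definition shifted_form ::
    "('v::complex_vector \<Rightarrow> 'v \<Rightarrow> complex) \<Rightarrow> ('v \<Rightarrow> 'h::chilbert_space) \<Rightarrow> real \<Rightarrow> 'v \<Rightarrow> 'v \<Rightarrow> complex"
  where "shifted_form a j \<gamma> u v = a u v + complex_of_real (1 - \<gamma>) * cinner (j u) (j v)"

lemma shifted_form_diagonal:
  "shifted_form a j \<gamma> u u =
    a u u - complex_of_real (\<gamma> * (norm (j u))\<^sup>2) + complex_of_real ((norm (j u))\<^sup>2)"
  by (simp add: shifted_form_def cinner_self algebra_simps)

lemma form_norm_shifted_form: "form_norm (shifted_form a j \<gamma>) = form_seminorm a j \<gamma>"
  by (simp add: fun_eq_iff form_norm_def form_seminorm_def shifted_form_def cinner_self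
      flip: of_real_power)

text \<open>Subtracting \<open>\<gamma>\<close> moves the vertex to zero. The further summand
  \<open>(norm (j u))\<^sup>2\<close> is real and nonnegative, so it preserves the sector
  inequality, and it makes the seminorm dominate \<open>norm (j u)\<close>.\<close>

lemma sectorial_form_map_shifted_form:
  assumes a: "sesquilinear a" and j: "clinear j" and sect: "j_sectorial_with a j \<gamma> \<theta>"
  shows "sectorial_form_map (shifted_form a j \<gamma>) (tan \<theta>) j"
proof -
  have \<theta>: "0 \<le> \<theta>" "\<theta> < pi / 2"
    using sect by (auto simp: j_sectorial_with_def)
  have tan: "0 \<le> tan \<theta>"
    using \<theta> tan_pos_pi2_le by simp
  have j_add: "j (u + v) = j u + j v" and j_scale: "j (c *\<^sub>C u) = c *\<^sub>C j u" for u v c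
    using j by (simp_all add: module_hom_iff_linear[symmetric] module_hom.add module_hom.scale)
  define r where "r u = a u u - complex_of_real (\<gamma> * (norm (j u))\<^sup>2)" for u
  have r: "0 \<le> Re (r u)" "\<bar>Im (r u)\<bar> \<le> tan \<theta> * Re (r u)" for u
    using sect sector_iff[OF \<theta>] by (auto simp: j_sectorial_with_def r_def)
  have diag: "shifted_form a j \<gamma> u u = r u + complex_of_real ((norm (j u))\<^sup>2)" for u
    by (simp only: shifted_form_diagonal r_def)
  then have Re: "Re (shifted_form a j \<gamma> u u) = Re (r u) + (norm (j u))\<^sup>2" for u
    by simp
  have Im: "Im (shifted_form a j \<gamma> u u) = Im (r u)" for u
    using diag by simp
  show ?thesis
  proof (intro sectorial_form_map.intro sectorial_form.intro sectorial_form_map_axioms.intro)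
    show "sesquilinear (shifted_form a j \<gamma>)"
      unfolding sesquilinear_def shifted_form_def
      by (simp add: sesquilinearD[OF a] j_add j_scale cinner_add_left cinner_add_right
          cinner_scaleC_left cinner_scaleC_right algebra_simps)
    show "0 \<le> tan \<theta>" by (rule tan)
    show "0 \<le> Re (shifted_form a j \<gamma> u u)" for u
      using r by (simp add: Re)
    show "\<bar>Im (shifted_form a j \<gamma> u u)\<bar> \<le> tan \<theta> * Re (shifted_form a j \<gamma> u u)" for u
      using r(2)[of u] tan by (simp add: Re Im distrib_left add_increasing2)
    show "clinear j" by (rule j)
    show "norm (j u) \<le> form_norm (shifted_form a j \<gamma>) u" for u
      unfolding form_norm_def Re using r(1)[of u] by (intro real_le_rsqrt) simp
  qed
qed

text \<open>The added inner product converges by itself and can be added or subtracted. The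
  hypothesis is the common consequence of the weak convergence in (a) and the norm convergence in
  (c).\<close>

lemma shifted_form_tendsto_iff:
  assumes "\<And>h. (\<lambda>n. cinner (j (u n)) h) \<longlonglongrightarrow> cinner x h"
  shows "(\<lambda>n. shifted_form a j \<gamma> (u n) v) \<longlonglongrightarrow> cinner (f + complex_of_real (1 - \<gamma>) *\<^sub>C x) (j v)
    \<longleftrightarrow> (\<lambda>n. a (u n) v) \<longlonglongrightarrow> cinner f (j v)"
proof -
  have shift: "(\<lambda>n. complex_of_real (1 - \<gamma>) * cinner (j (u n)) (j v))
      \<longlonglongrightarrow> complex_of_real (1 - \<gamma>) * cinner x (j v)"
    by (intro tendsto_mult tendsto_const assms)
  show ?thesis
    unfolding shifted_form_def cinner_add_left cinner_scaleC_left
    using tendsto_add[OF _ shift, of "\<lambda>n. a (u n) v" "cinner f (j v)"]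
      tendsto_diff[OF _ shift, of "\<lambda>n. a (u n) v + complex_of_real (1 - \<gamma>) * cinner (j (u n)) (j v)"
        "cinner f (j v) + complex_of_real (1 - \<gamma>) * cinner x (j v)"]
    by (auto simp only: add_diff_cancel_right')
qed

lemma shifted_form_bdd_above_iff:
  fixes u :: "nat \<Rightarrow> 'v::complex_vector"
  assumes "bounded (range (\<lambda>n. j (u n)))"
  shows "bdd_above (range (\<lambda>n. Re (shifted_form a j \<gamma> (u n) (u n))))
    \<longleftrightarrow> bdd_above (range (\<lambda>n. Re (a (u n) (u n))))"
proof -
  obtain C where C: "\<And>n. norm (j (u n)) \<le> C"
    using assms by (auto simp: bounded_iff)
  define s where "s n = (1 - \<gamma>) * (norm (j (u n)))\<^sup>2" for n
  have s: "\<bar>s n\<bar> \<le> \<bar>1 - \<gamma>\<bar> * C\<^sup>2" for n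
    using power_mono[OF C[of n], of 2] by (simp add: s_def abs_mult mult_left_mono)
  have "Re (shifted_form a j \<gamma> (u n) (u n)) = Re (a (u n) (u n)) + s n" for n
    by (simp add: shifted_form_def cinner_self s_def flip: of_real_power)
  then have diff: "\<bar>Re (shifted_form a j \<gamma> (u n) (u n)) - Re (a (u n) (u n))\<bar> \<le> \<bar>1 - \<gamma>\<bar> * C\<^sup>2" for n
    using s[of n] by simp
  have transfer: "bdd_above (range q)" if "bdd_above (range p)" "\<And>n. \<bar>p n - q n\<bar> \<le> K"
    for p q :: "nat \<Rightarrow> real" and K
  proof -
    obtain M where M: "\<And>n. p n \<le> M"
      using \<open>bdd_above (range p)\<close> by (auto simp: bdd_above_def)
    have "q n \<le> M + K" for n
      using M[of n] that(2)[of n] by linarith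
    then show ?thesis
      by (intro bdd_aboveI[of _ "M + K"]) auto
  qed
  show ?thesis
  proof
    assume "bdd_above (range (\<lambda>n. Re (shifted_form a j \<gamma> (u n) (u n))))"
    then show "bdd_above (range (\<lambda>n. Re (a (u n) (u n))))"
      by (rule transfer) (rule diff)
  next
    assume "bdd_above (range (\<lambda>n. Re (a (u n) (u n))))"
    then show "bdd_above (range (\<lambda>n. Re (shifted_form a j \<gamma> (u n) (u n))))"
      by (rule transfer) (subst abs_minus_commute, rule diff)
  qed
qed

section \<open>The operator and the proof of (a), (b) and (c)\<close>

theorem theorem3p2:
  fixes a :: "'v::complex_vector \<Rightarrow> 'v \<Rightarrow> complex"
    and j :: "'v \<Rightarrow> 'h::chilbert_space"
  assumes "sesquilinear a"
    and "clinear j"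
    and "j_sectorial a j"
    and "closure (range j) = UNIV"
  shows "\<exists>A :: 'h \<rightharpoonup> 'h.
    (linear_operator A \<and>
      (\<forall>x f. A x = Some f \<longleftrightarrow>
        (\<exists>u :: nat \<Rightarrow> 'v.
          weakly_tendsto (\<lambda>n. j (u n)) x \<and>
          bdd_above (range (\<lambda>n. Re (a (u n) (u n)))) \<and>
          (\<forall>v. (\<lambda>n. a (u n) v) \<longlonglongrightarrow> cinner f (j v))))) \<and>
    m_sectorial A \<and>
    (\<forall>\<gamma> \<theta>. j_sectorial_with a j \<gamma> \<theta> \<longrightarrow>
      (\<forall>x f. A x = Some f \<longleftrightarrow>
        (\<exists>u :: nat \<Rightarrow> 'v.
          seminorm_Cauchy (form_seminorm a j \<gamma>) u \<and>
          (\<lambda>n. j (u n)) \<longlonglongrightarrow> x \<and>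
          (\<forall>v. (\<lambda>n. a (u n) v) \<longlonglongrightarrow> cinner f (j v)))))"
proof -
  define weak where "weak x f \<longleftrightarrow>
    (\<exists>u :: nat \<Rightarrow> 'v. weakly_tendsto (\<lambda>n. j (u n)) x \<and>
      bdd_above (range (\<lambda>n. Re (a (u n) (u n)))) \<and>
      (\<forall>v. (\<lambda>n. a (u n) v) \<longlonglongrightarrow> cinner f (j v)))" for x f
  \<comment> \<open>Passing to the shifted form replaces \<open>f\<close> by
    \<open>f + (1 - \<gamma>) x\<close>; \<open>graph\<close> undoes this shift.\<close>
  define graph where "graph \<gamma> x f \<longleftrightarrow>
    sectorial_form_map.form_graph (shifted_form a j \<gamma>) j x (f + complex_of_real (1 - \<gamma>) *\<^sub>C x)"
    for \<gamma> x f
  have weak_iff: "weak x f \<longleftrightarrow> graph \<gamma> x f" if "j_sectorial_with a j \<gamma> \<theta>" for \<gamma> \<theta> x f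
  proof -
    interpret sectorial_form_map "shifted_form a j \<gamma>" "tan \<theta>" j
      by (rule sectorial_form_map_shifted_form[OF assms(1,2) that])
    show ?thesis
      unfolding weak_def graph_def form_graph_iff_weak
      by (intro arg_cong[where f = Ex] ext conj_cong refl)
        (simp_all only: shifted_form_bdd_above_iff weakly_tendsto_imp_bounded
          shifted_form_tendsto_iff weakly_tendsto_cinner)
  qed
  have strong_iff: "graph \<gamma> x f \<longleftrightarrow>
      (\<exists>u :: nat \<Rightarrow> 'v. seminorm_Cauchy (form_seminorm a j \<gamma>) u \<and> (\<lambda>n. j (u n)) \<longlonglongrightarrow> x \<and>
        (\<forall>v. (\<lambda>n. a (u n) v) \<longlonglongrightarrow> cinner f (j v)))" if "j_sectorial_with a j \<gamma> \<theta>" for \<gamma> \<theta> x f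
  proof -
    interpret sectorial_form_map "shifted_form a j \<gamma>" "tan \<theta>" j
      by (rule sectorial_form_map_shifted_form[OF assms(1,2) that])
    show ?thesis
      unfolding graph_def form_graph_def form_norm_shifted_form
      by (intro arg_cong[where f = Ex] ext conj_cong refl)
        (simp_all only: shifted_form_tendsto_iff[OF tendsto_cinner[OF _ tendsto_const]])
  qed
  obtain \<gamma> \<theta> where sect: "j_sectorial_with a j \<gamma> \<theta>"
    using assms(3) unfolding j_sectorial_def by blast
  then have \<theta>: "0 \<le> \<theta>" "\<theta> < pi / 2"
    by (auto simp: j_sectorial_with_def)
  let ?c = "complex_of_real (1 - \<gamma>)"
  interpret sectorial_form_map "shifted_form a j \<gamma>" "tan \<theta>" j
    by (rule sectorial_form_map_shifted_form[OF assms(1,2) sect])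
  have graph_add: "graph \<gamma> (x + y) (f + g)" if "graph \<gamma> x f" "graph \<gamma> y g" for x y f g
    using form_graph_add[OF that[unfolded graph_def]]
    by (simp add: graph_def complex_vector.scale_right_distrib algebra_simps)
  have graph_scale: "graph \<gamma> (c *\<^sub>C x) (c *\<^sub>C f)" if "graph \<gamma> x f" for c x f
    using form_graph_scale[OF that[unfolded graph_def], of c]
    by (simp add: graph_def complex_vector.scale_right_distrib mult.commute)
  have graph_unique: "f = g" if "graph \<gamma> x f" "graph \<gamma> x g" for x f g
  proof -
    \<comment> \<open>By linearity the pair \<open>(0, f - g)\<close> lies in the graph, and density
      of the range of \<open>j\<close> forces \<open>f - g = 0\<close>.\<close>
    have "graph \<gamma> (x + (- 1) *\<^sub>C x) (f + (- 1) *\<^sub>C g)"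
      by (intro graph_add graph_scale that)
    then show ?thesis
      using form_graph_zero_imp_zero[OF assms(4), of "f - g"] by (simp add: graph_def)
  qed
  define A where "A x = (if \<exists>f. graph \<gamma> x f then Some (SOME f. graph \<gamma> x f) else None)" for x
  have A: "A x = Some f \<longleftrightarrow> graph \<gamma> x f" for x f
  proof (cases "\<exists>f. graph \<gamma> x f")
    case True
    then have "graph \<gamma> x (SOME f. graph \<gamma> x f)"
      by (rule someI_ex)
    then show ?thesis
      using True by (auto simp: A_def intro: graph_unique)
  qed (simp add: A_def)
  have linear: "linear_operator A"
  proof -
    \<comment> \<open>Surjectivity supplies some element of the graph; scaling it by zero gives the
      pair of zeros.\<close>
    have "graph \<gamma> 0 0"
    proof -
      obtain x where x: "form_graph x 0"
        using form_graph_surj by blast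
      then show ?thesis
        using form_graph_scale[OF x, of 0] by (simp add: graph_def)
    qed
    have dom: "x \<in> dom A \<longleftrightarrow> (\<exists>f. graph \<gamma> x f)" for x
      by (simp add: dom_def A)
    have "csubspace (dom A)"
    proof (intro complex_vector.subspaceI)
      show "0 \<in> dom A"
        unfolding dom by (rule exI) (rule \<open>graph \<gamma> 0 0\<close>)
      show "x + y \<in> dom A" if "x \<in> dom A" "y \<in> dom A" for x y
        using that unfolding dom by (elim exE) (rule exI, rule graph_add)
      show "c *\<^sub>C x \<in> dom A" if "x \<in> dom A" for c x
        using that unfolding dom by (elim exE) (rule exI, rule graph_scale)
    qed
    then show ?thesis
      unfolding linear_operator_def A by (intro conjI allI impI graph_add graph_scale)
  qed
  have m_sectorial: "m_sectorial A"
  proof -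
    have "sectorial_with A \<gamma> \<theta>"
      unfolding sectorial_with_def A
    proof (intro conjI allI impI)
      show "\<theta> \<in> {0..<pi / 2}"
        using \<theta> by simp
      fix x f
      assume "graph \<gamma> x f"
      then obtain u where u: "seminorm_Cauchy (form_norm (shifted_form a j \<gamma>)) u"
          "(\<lambda>n. j (u n)) \<longlonglongrightarrow> x"
          "\<And>v. (\<lambda>n. shifted_form a j \<gamma> (u n) v) \<longlonglongrightarrow> cinner (f + ?c *\<^sub>C x) (j v)"
        unfolding graph_def form_graph_def by blast
      \<comment> \<open>Subtracting \<open>(norm (j (u n)))\<^sup>2\<close> leaves
        \<open>a (u n) (u n)\<close> minus the vertex term, which lies in the sector. The limit
        inherits the two sector inequalities, so \<open>A\<close> has the same vertex and semi-angle
        as the form.\<close>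
      have limit: "(\<lambda>n. shifted_form a j \<gamma> (u n) (u n) - complex_of_real ((norm (j (u n)))\<^sup>2))
          \<longlonglongrightarrow> cinner (f + ?c *\<^sub>C x) x - complex_of_real ((norm x)\<^sup>2)" (is "?r \<longlonglongrightarrow> ?l")
        by (intro tendsto_diff tendsto_form_diagonal tendsto_of_real tendsto_power tendsto_norm u)
      have l: "?l = cinner f x - complex_of_real (\<gamma> * (norm x)\<^sup>2)"
        by (simp only: cinner_add_left cinner_scaleC_left cinner_self) (simp add: algebra_simps)
      have "?r n \<in> sector \<theta>" for n
        using sect by (simp add: shifted_form_diagonal j_sectorial_with_def)
      then have r: "0 \<le> Re (?r n)" "\<bar>Im (?r n)\<bar> \<le> tan \<theta> * Re (?r n)" for n
        using sector_iff[OF \<theta>] by blast+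
      have "0 \<le> Re ?l"
        using r(1) by (intro LIMSEQ_le_const[OF tendsto_Re[OF limit]]) blast
      moreover have "\<bar>Im ?l\<bar> \<le> tan \<theta> * Re ?l"
        using r(2) by (intro LIMSEQ_le[OF tendsto_rabs[OF tendsto_Im[OF limit]]
              tendsto_mult[OF tendsto_const tendsto_Re[OF limit]]]) blast
      ultimately show "cinner f x - complex_of_real (\<gamma> * (norm x)\<^sup>2) \<in> sector \<theta>"
        unfolding l[symmetric] sector_iff[OF \<theta>] by simp
    qed
    \<comment> \<open>The value \<open>\<gamma> - 1\<close> lies below the vertex, and the equation
      reads \<open>f + (1 - \<gamma>) x = - y\<close>, which is solvability for the shifted
      form.\<close>
    moreover have "\<exists>x f. A x = Some f \<and> complex_of_real (\<gamma> - 1) *\<^sub>C x - f = y" for y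
    proof -
      obtain x where x: "form_graph x (- y)"
        using form_graph_surj by blast
      define f where "f = complex_of_real (\<gamma> - 1) *\<^sub>C x - y"
      have "complex_of_real (\<gamma> - 1) *\<^sub>C x + ?c *\<^sub>C x = 0"
        by (simp flip: complex_vector.scale_left_distrib)
      then have "f + ?c *\<^sub>C x = - y"
        by (simp add: f_def algebra_simps)
      with x have "A x = Some f"
        by (simp only: A graph_def)
      then show ?thesis
        by (intro exI conjI) (assumption, simp add: f_def)
    qed
    ultimately show ?thesis
      unfolding m_sectorial_def by (intro exI[of _ \<gamma>] exI[of _ \<theta>] conjI exI[of _ "\<gamma> - 1"]) auto
  qed
  have A_weak: "A x = Some f \<longleftrightarrow> weak x f" for x f
    by (simp only: A weak_iff[OF sect])
  \<comment> \<open>\<open>A\<close> was built from one vertex; since \<open>weak\<close> mentions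
    no vertex, it links that choice to any other \<open>\<gamma>'\<close>.\<close>
  have A_strong: "A x = Some f \<longleftrightarrow>
      (\<exists>u :: nat \<Rightarrow> 'v. seminorm_Cauchy (form_seminorm a j \<gamma>') u \<and> (\<lambda>n. j (u n)) \<longlonglongrightarrow> x \<and>
        (\<forall>v. (\<lambda>n. a (u n) v) \<longlonglongrightarrow> cinner f (j v)))" if "j_sectorial_with a j \<gamma>' \<theta>'" for \<gamma>' \<theta>' x f
    by (simp only: A_weak weak_iff[OF that] strong_iff[OF that])
  show ?thesis
    by (intro exI[of _ A] conjI allI impI linear m_sectorial A_weak[unfolded weak_def] A_strong)
qed

end
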